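(* Let $k$ be an algebraically closed field of characteristic zero, let $\mathcal{O}$ be a complete local noetherian integral $k$-algebra of dimension one with normalization $k[[t]]$, and let $\Gamma$ be its semigroup. Let $S$ be a $\Gamma$-module. Then the following algorithm terminates after a finite number of steps and its output $A$ is the minimal generating set of $S$: start with $A:=\emptyset$ and $T:=S$; while $T\ne\emptyset$, replace $A$ by $A\cup\{\min T\}$ and replace $T$ by $T\setminus\{\min T+\gamma\mid\gamma\in\Gamma\}$ (with the same value of $\min T$ in both replacements).
   Context: For nonzero $f\in k[[t]]$, $\mathrm{ord}(f)$ is its $t$-order, and $\Gamma=\{\mathrm{ord}(f)\mid 0\neq f\in\mathcal{O}\}$. A $\Gamma$-module is a subset $S\subseteq\Gamma$ with $s_1+s_2\in S$ for all $s_1,s_2\in S$ and $s+\gamma\in S$ for all $s\in S$, $\gamma\in\Gamma$. A set $A=\{\alpha_1,\dots,\alpha_m\}\subseteq S$ is a generating set of $S$ if $S=\bigcup_{i=1}^m(\alpha_i+\Gamma)$, where $\alpha+\Gamma=\{\alpha+\gamma\mid\gamma\in\Gamma\}$. A generating set $A$ is minimal if, for every $\alpha\in A$, the set $A\setminus\{\alpha\}$ does not generate $S$. *)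

theory Defs
  imports
    "HOL-Algebra.Ideal_Product"
    "HOL-Algebra.Algebraic_Closure_Type"
    "HOL-Computational_Algebra.Formal_Laurent_Series"
    "HOL-Library.Extended_Nat"
    "HOL-Library.While_Combinator"
begin

definition local_ring :: "('a, 'b) ring_scheme \<Rightarrow> bool" where
  "local_ring R \<longleftrightarrow> cring R \<and> (\<exists>!M. maximalideal M R)"

text \<open>
  The two conjuncts are injectivity and surjectivity of the canonical map from \<open>R\<close> to the
  inverse limit of the rings \<open>R / I\<^sup>n\<close>: an element of the limit is given by a sequence of
  representatives \<open>x n\<close> that are compatible modulo \<open>I\<^sup>n\<close>.
  Powers of \<open>I\<close> are taken in the multiplicative monoid of ideals of \<open>R\<close>.
\<close>
definition adically_complete :: "('a, 'b) ring_scheme \<Rightarrow> 'a set \<Rightarrow> bool" where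
  "adically_complete R I \<longleftrightarrow>
     (\<Inter>n::nat. I [^]\<^bsub>ideals_set R\<^esub> n) = {\<zero>\<^bsub>R\<^esub>} \<and>
     (\<forall>x. (\<forall>n::nat. x n \<in> carrier R \<and> x (Suc n) \<ominus>\<^bsub>R\<^esub> x n \<in> I [^]\<^bsub>ideals_set R\<^esub> n) \<longrightarrow>
          (\<exists>l \<in> carrier R. \<forall>n. l \<ominus>\<^bsub>R\<^esub> x n \<in> I [^]\<^bsub>ideals_set R\<^esub> n))"

definition complete_local_ring :: "('a, 'b) ring_scheme \<Rightarrow> bool" where
  "complete_local_ring R \<longleftrightarrow>
     local_ring R \<and> (\<forall>M. maximalideal M R \<longrightarrow> adically_complete R M)"

definition krull_dim :: "('a, 'b) ring_scheme \<Rightarrow> enat" where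
  "krull_dim R = Sup (enat ` {n. \<exists>P. (\<forall>i\<le>n. primeideal (P i) R) \<and> (\<forall>i<n. P i \<subset> P (Suc i))})"

definition fraction_field_in :: "'a::field set \<Rightarrow> 'a set" where
  "fraction_field_in A = {a / b | a b. a \<in> A \<and> b \<in> A \<and> b \<noteq> 0}"

definition integral_over :: "'a::field set \<Rightarrow> 'a \<Rightarrow> bool" where
  "integral_over A x \<longleftrightarrow>
     (\<exists>p. Polynomial.lead_coeff p = 1 \<and> (\<forall>i. Polynomial.coeff p i \<in> A) \<and> poly p x = 0)"

definition normalization_in :: "'a::field set \<Rightarrow> 'a set" where
  "normalization_in A = {x \<in> fraction_field_in A. integral_over A x}"

text \<open>
  The ring is given as a \<open>k\<close>-subalgebra \<open>A\<close> of \<open>k[[t]]\<close>, embedded by its normalization map;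
  fractions are formed inside the field \<open>k((t))\<close> of formal Laurent series.
\<close>
locale complete_branch =
  fixes A :: "'k::{alg_closed_field, field_char_0} fps set"
  assumes subring: "subring A (ring_of_type_algebra :: 'k fps ring)"
    and constants: "range fps_const \<subseteq> A"
    and noetherian_domain: "noetherian_domain (ring_of_type_algebra\<lparr>carrier := A\<rparr>)"
    and complete_local: "complete_local_ring (ring_of_type_algebra\<lparr>carrier := A\<rparr>)"
    and dim_one: "krull_dim (ring_of_type_algebra\<lparr>carrier := A\<rparr>) = 1"
    and normalization: "normalization_in (fps_to_fls ` A) = range fps_to_fls"

definition value_semigroup :: "'k::field fps set \<Rightarrow> nat set" where
  "value_semigroup A = {subdegree f | f. f \<in> A \<and> f \<noteq> 0}"

definition semigroup_module :: "nat set \<Rightarrow> nat set \<Rightarrow> bool" where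
  "semigroup_module \<Gamma> S \<longleftrightarrow>
     S \<subseteq> \<Gamma> \<and> (\<forall>s\<^sub>1\<in>S. \<forall>s\<^sub>2\<in>S. s\<^sub>1 + s\<^sub>2 \<in> S) \<and> (\<forall>s\<in>S. \<forall>\<gamma>\<in>\<Gamma>. s + \<gamma> \<in> S)"

definition generating_set :: "nat set \<Rightarrow> nat set \<Rightarrow> nat set \<Rightarrow> bool" where
  "generating_set \<Gamma> S A \<longleftrightarrow>
     finite A \<and> A \<subseteq> S \<and> S = (\<Union>\<alpha>\<in>A. {\<alpha> + \<gamma> | \<gamma>. \<gamma> \<in> \<Gamma>})"

definition minimal_generating_set :: "nat set \<Rightarrow> nat set \<Rightarrow> nat set \<Rightarrow> bool" where
  "minimal_generating_set \<Gamma> S A \<longleftrightarrow>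
     generating_set \<Gamma> S A \<and> (\<forall>\<alpha>\<in>A. \<not> generating_set \<Gamma> S (A - {\<alpha>}))"

definition algorithm_step :: "nat set \<Rightarrow> nat set \<times> nat set \<Rightarrow> nat set \<times> nat set" where
  "algorithm_step \<Gamma> = (\<lambda>(A, T). let m = (LEAST x. x \<in> T) in
     (A \<union> {m}, T - {m + \<gamma> | \<gamma>. \<gamma> \<in> \<Gamma>}))"

text \<open>The result is \<open>None\<close> if the loop does not terminate.\<close>
definition algorithm :: "nat set \<Rightarrow> nat set \<Rightarrow> (nat set \<times> nat set) option" where
  "algorithm \<Gamma> S = while_option (\<lambda>(A, T). T \<noteq> {}) (algorithm_step \<Gamma>) ({}, S)"

end

theory Submission
  imports Defs
begin

text \<open>
  Call an element of \<open>S\<close> indecomposable if it is not \<open>s + \<gamma>\<close> with \<open>s \<in> S\<close> and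
  \<open>0 \<noteq> \<gamma> \<in> \<Gamma>\<close>. The indecomposable elements generate \<open>S\<close> and lie in every generating set, so
  they form the unique minimal one. Two of them cannot be congruent modulo a positive
  \<open>e \<in> \<Gamma>\<close>, so there are at most \<open>e\<close> of them. Each step of the algorithm adds a new
  indecomposable element. A positive \<open>e\<close> exists because \<open>t\<close> is a quotient of two elements of
  the ring, whose orders therefore differ by one.
\<close>

definition indecomposables :: "nat set \<Rightarrow> nat set \<Rightarrow> nat set" where
  "indecomposables \<Gamma> S = {s \<in> S. \<forall>s'\<in>S. \<forall>\<gamma>\<in>\<Gamma>. s = s' + \<gamma> \<longrightarrow> \<gamma> = 0}"

lemma indecomposables_subset: "indecomposables \<Gamma> S \<subseteq> S"
  unfolding indecomposables_def by auto

text \<open>An indecomposable \<open>m\<close> written as \<open>b + \<gamma>\<close> with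
  \<open>b\<close> in \<open>B\<close> has \<open>\<gamma> = 0\<close>. The inclusions are stated
  separately so that the lemma applies both to generating sets and to the output of the
  loop.\<close>

lemma indecomposables_subset_generators:
  assumes "B \<subseteq> S" "S \<subseteq> (\<Union>\<alpha>\<in>B. {\<alpha> + \<gamma> | \<gamma>. \<gamma> \<in> \<Gamma>})"
  shows "indecomposables \<Gamma> S \<subseteq> B"
proof
  fix m assume m: "m \<in> indecomposables \<Gamma> S"
  then have "m \<in> S"
    using indecomposables_subset by blast
  with assms(2) obtain b \<gamma> where b: "b \<in> B" "\<gamma> \<in> \<Gamma>" "m = b + \<gamma>"
    by blast
  moreover have "b \<in> S" using b(1) assms(1) by blast
  ultimately have "\<gamma> = 0"
    using m unfolding indecomposables_def by blast
  with b show "m \<in> B" by simp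
qed

text \<open>Isolates the combinatorics from power series; \<open>e\<close> is fixed to serve as a
  modulus.\<close>

locale nontrivial_semigroup =
  fixes \<Gamma> :: "nat set" and e :: nat
  assumes zero_mem: "0 \<in> \<Gamma>"
    and add_mem: "a \<in> \<Gamma> \<Longrightarrow> b \<in> \<Gamma> \<Longrightarrow> a + b \<in> \<Gamma>"
    and e_mem: "e \<in> \<Gamma>"
    and e_pos: "e > 0"
begin

lemma mult_e_mem: "k * e \<in> \<Gamma>"
  by (induction k) (simp_all add: zero_mem add_mem e_mem)

lemma finite_indecomposables: "finite (indecomposables \<Gamma> S)"
proof (rule finite_imageD)
  show "finite ((\<lambda>x. x mod e) ` indecomposables \<Gamma> S)"
    by (rule finite_subset[of _ "{..<e}"]) (use e_pos in auto)
  \<comment> \<open>Here \<open>b\<close> is \<open>a\<close> plus a multiple of \<open>e\<close>,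
    and such multiples lie in \<open>\<Gamma>\<close>; indecomposability of \<open>b\<close> makes
    the multiple zero.\<close>
  have "a = b"
    if a: "a \<in> indecomposables \<Gamma> S" and b: "b \<in> indecomposables \<Gamma> S"
      and mod: "a mod e = b mod e" and le: "a \<le> b" for a b
  proof -
    have "e dvd b - a"
      using mod le by (metis mod_eq_dvd_iff_nat)
    then obtain k where "b - a = k * e"
      by (metis dvdE mult.commute)
    with le have eq: "b = a + k * e" by simp
    have "a \<in> S"
      using a indecomposables_subset by blast
    with b eq mult_e_mem[of k] have "k * e = 0"
      unfolding indecomposables_def by blast
    with eq show ?thesis by simp
  qed
  then show "inj_on (\<lambda>x. x mod e) (indecomposables \<Gamma> S)"
    by (intro linorder_inj_onI) (blast dest: less_imp_le less_imp_neq, linarith)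
qed

text \<open>Strong induction: splitting off a nonzero \<open>\<gamma>\<close> leaves a smaller
  element of \<open>S\<close>, and the summands split off add up within
  \<open>\<Gamma>\<close>.\<close>

lemma indecomposables_generate:
  assumes "s \<in> S"
  shows "\<exists>m\<in>indecomposables \<Gamma> S. \<exists>\<gamma>\<in>\<Gamma>. s = m + \<gamma>"
  using assms
proof (induction s rule: less_induct)
  case (less s)
  show ?case
  proof (cases "s \<in> indecomposables \<Gamma> S")
    case True
    then show ?thesis using zero_mem by force
  next
    case False
    then obtain s' \<gamma> where s': "s' \<in> S" "\<gamma> \<in> \<Gamma>" "s = s' + \<gamma>" "\<gamma> \<noteq> 0"
      using less.prems unfolding indecomposables_def by auto
    then obtain m \<gamma>' where "m \<in> indecomposables \<Gamma> S" "\<gamma>' \<in> \<Gamma>" "s' = m + \<gamma>'"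
      using less.IH[of s'] by auto
    then show ?thesis
      using s' add_mem by (metis add.assoc)
  qed
qed

text \<open>Being a module keeps all translates inside \<open>S\<close>. Minimality thus becomes a
  question about finite sets between \<open>indecomposables \<Gamma> S\<close> and \<open>S\<close>,
  where the least one is the only minimal one.\<close>

lemma generating_set_iff:
  assumes "semigroup_module \<Gamma> S"
  shows "generating_set \<Gamma> S B \<longleftrightarrow> finite B \<and> B \<subseteq> S \<and> indecomposables \<Gamma> S \<subseteq> B"
proof
  assume "generating_set \<Gamma> S B"
  then have "finite B" "B \<subseteq> S" "S \<subseteq> (\<Union>\<alpha>\<in>B. {\<alpha> + \<gamma> | \<gamma>. \<gamma> \<in> \<Gamma>})"
    unfolding generating_set_def by blast+
  then show "finite B \<and> B \<subseteq> S \<and> indecomposables \<Gamma> S \<subseteq> B"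
    using indecomposables_subset_generators by blast
next
  assume "finite B \<and> B \<subseteq> S \<and> indecomposables \<Gamma> S \<subseteq> B"
  then have B: "finite B" "B \<subseteq> S" "indecomposables \<Gamma> S \<subseteq> B" by auto
  have "(\<Union>\<alpha>\<in>B. {\<alpha> + \<gamma> | \<gamma>. \<gamma> \<in> \<Gamma>}) \<subseteq> S"
    using B(2) assms unfolding semigroup_module_def by auto
  moreover have "S \<subseteq> (\<Union>\<alpha>\<in>B. {\<alpha> + \<gamma> | \<gamma>. \<gamma> \<in> \<Gamma>})"
    using indecomposables_generate B(3) by blast
  ultimately show "generating_set \<Gamma> S B"
    using B unfolding generating_set_def by blast
qed

lemma minimal_generating_set_iff:
  assumes "semigroup_module \<Gamma> S"
  shows "minimal_generating_set \<Gamma> S B \<longleftrightarrow> B = indecomposables \<Gamma> S"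
  unfolding minimal_generating_set_def generating_set_iff[OF assms]
  using finite_indecomposables[of S] indecomposables_subset[of \<Gamma> S] by blast

text \<open>The bound on \<open>A\<close> yields termination, since there are finitely many
  indecomposables; the formula for \<open>T\<close> turns the exit condition into generation of
  \<open>S\<close> by \<open>A\<close>.\<close>

definition algorithm_invariant :: "nat set \<Rightarrow> nat set \<times> nat set \<Rightarrow> bool" where
  "algorithm_invariant S = (\<lambda>(A, T).
     A \<subseteq> indecomposables \<Gamma> S \<and> T = S - (\<Union>\<alpha>\<in>A. {\<alpha> + \<gamma> | \<gamma>. \<gamma> \<in> \<Gamma>}))"

lemma least_remaining:
  assumes inv: "algorithm_invariant S (A, T)" and "T \<noteq> {}"
  defines "m \<equiv> LEAST x. x \<in> T"
  shows "m \<in> indecomposables \<Gamma> S - A"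
proof -
  have T: "T = S - (\<Union>\<alpha>\<in>A. {\<alpha> + \<gamma> | \<gamma>. \<gamma> \<in> \<Gamma>})"
    using inv unfolding algorithm_invariant_def by simp
  have mT: "m \<in> T"
    unfolding m_def using \<open>T \<noteq> {}\<close> by (meson LeastI ex_in_conv)
  have "\<gamma> = 0" if s: "s \<in> S" "\<gamma> \<in> \<Gamma>" "m = s + \<gamma>" for s \<gamma>
  proof (rule ccontr)
    assume "\<gamma> \<noteq> 0"
    with s have "s < m" by simp
    \<comment> \<open>An element of \<open>S\<close> below the minimum of \<open>T\<close> is
      already covered by some \<open>\<alpha>\<close> in \<open>A\<close>; the same
      \<open>\<alpha>\<close> then covers \<open>m\<close>, which contradicts \<open>m\<close> being
      in \<open>T\<close>.\<close>
    then have "s \<notin> T"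
      unfolding m_def by (rule not_less_Least)
    then obtain \<alpha> \<gamma>' where "\<alpha> \<in> A" "\<gamma>' \<in> \<Gamma>" "s = \<alpha> + \<gamma>'"
      using s(1) unfolding T by blast
    then have "m \<in> {\<alpha> + \<gamma> | \<gamma>. \<gamma> \<in> \<Gamma>}"
      using s(2,3) add_mem by (auto simp: add.assoc)
    with \<open>\<alpha> \<in> A\<close> mT show False unfolding T by blast
  qed
  \<comment> \<open>As \<open>0\<close> is in \<open>\<Gamma>\<close>, every element of
    \<open>A\<close> covers itself and so is missing from \<open>T\<close>.\<close>
  moreover have "m \<notin> A"
    using mT zero_mem unfolding T by force
  ultimately show ?thesis
    using mT unfolding T indecomposables_def by blast
qed

lemma algorithm_invariant_step:
  assumes "algorithm_invariant S (A, T)" "T \<noteq> {}"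
  shows "algorithm_invariant S (algorithm_step \<Gamma> (A, T))"
  using least_remaining[OF assms] assms(1)
  unfolding algorithm_invariant_def algorithm_step_def Let_def by auto

lemma algorithm_eq: "algorithm \<Gamma> S = Some (indecomposables \<Gamma> S, {})"
proof -
  let ?b = "\<lambda>(A, T). T \<noteq> ({} :: nat set)"
  have init: "algorithm_invariant S ({}, S)"
    unfolding algorithm_invariant_def by simp
  have "\<exists>r. while_option ?b (algorithm_step \<Gamma>) ({}, S) = Some r"
  \<comment> \<open>The measure counts the indecomposables not yet collected.\<close>
  proof (rule measure_while_option_Some[where P = "algorithm_invariant S"
        and f = "\<lambda>(A, T). card (indecomposables \<Gamma> S - A)"])
    fix s assume s: "algorithm_invariant S s" "?b s"
    obtain A T where AT: "s = (A, T)" by (cases s)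
    define m where "m = (LEAST x. x \<in> T)"
    have inv: "algorithm_invariant S (A, T)" and ne: "T \<noteq> {}"
      using s AT by auto
    have "m \<in> indecomposables \<Gamma> S - A"
      unfolding m_def using inv ne by (rule least_remaining)
    then have "indecomposables \<Gamma> S - (A \<union> {m}) \<subset> indecomposables \<Gamma> S - A"
      by blast
    then have "card (indecomposables \<Gamma> S - (A \<union> {m})) < card (indecomposables \<Gamma> S - A)"
      using finite_indecomposables by (intro psubset_card_mono) auto
    with algorithm_invariant_step[OF inv ne]
    show "algorithm_invariant S (algorithm_step \<Gamma> s) \<and>
        (case algorithm_step \<Gamma> s of (A, T) \<Rightarrow> card (indecomposables \<Gamma> S - A))
          < (case s of (A, T) \<Rightarrow> card (indecomposables \<Gamma> S - A))"
      unfolding AT by (simp add: algorithm_step_def Let_def m_def)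
  qed (fact init)
  then obtain A T where res: "while_option ?b (algorithm_step \<Gamma>) ({}, S) = Some (A, T)"
    by auto
  have T: "T = {}"
    using while_option_stop[OF res] by simp
  have "algorithm_invariant S (A, T)"
    by (rule while_option_rule[where P = "algorithm_invariant S", OF _ res init])
      (auto intro: algorithm_invariant_step)
  then have sub: "A \<subseteq> indecomposables \<Gamma> S" and cover: "S \<subseteq> (\<Union>\<alpha>\<in>A. {\<alpha> + \<gamma> | \<gamma>. \<gamma> \<in> \<Gamma>})"
    unfolding algorithm_invariant_def T by auto
  \<comment> \<open>With \<open>T\<close> empty, \<open>A\<close> covers \<open>S\<close>, so it
    cannot miss an indecomposable.\<close>
  have "indecomposables \<Gamma> S \<subseteq> A"
    using sub indecomposables_subset cover by (intro indecomposables_subset_generators) blast+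
  with sub have "A = indecomposables \<Gamma> S" by blast
  then show ?thesis
    unfolding algorithm_def res T by simp
qed

end

context complete_branch
begin

lemma value_semigroup_zero: "0 \<in> value_semigroup A"
proof -
  have "fps_const 1 \<in> A"
    using constants by blast
  then show ?thesis
    unfolding value_semigroup_def by force
qed

lemma value_semigroup_add:
  assumes "a \<in> value_semigroup A" "b \<in> value_semigroup A"
  shows "a + b \<in> value_semigroup A"
proof -
  obtain f g where "f \<in> A" "f \<noteq> 0" "a = subdegree f" "g \<in> A" "g \<noteq> 0" "b = subdegree g"
    using assms unfolding value_semigroup_def by blast
  moreover from this have "f * g \<in> A"
    using subringE(6)[OF subring] by (simp add: ring_of_type_algebra_def)
  ultimately show ?thesis
    unfolding value_semigroup_def by (auto intro!: exI[of _ "f * g"])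
qed

lemma value_semigroup_pos: "\<exists>e\<in>value_semigroup A. e > 0"
proof -
  \<comment> \<open>The variable is a power series, hence in the normalization, hence a
    fraction.\<close>
  have "fps_to_fls fps_X \<in> fraction_field_in (fps_to_fls ` A)"
    using normalization unfolding normalization_in_def by blast
  then obtain a b where ab: "a \<in> A" "b \<in> A" "fps_to_fls b \<noteq> 0"
      "fps_to_fls fps_X = fps_to_fls a / fps_to_fls b"
    unfolding fraction_field_in_def by auto
  then have "fps_to_fls a = fps_to_fls (fps_X * b)"
    by (simp add: field_simps fls_times_fps_to_fls)
  then have a: "a = fps_X * b"
    by (simp only: fps_to_fls_eq_iff)
  have "b \<noteq> 0" using ab(3) by auto
  \<comment> \<open>The numerator \<open>a\<close> has order at least one and is the
    witness.\<close>
  with a have "a \<noteq> 0" "subdegree a = Suc (subdegree b)" by simp_all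
  with ab(1) show ?thesis
    unfolding value_semigroup_def by force
qed

end

theorem proposition5:
  fixes \<O> :: "'k::{alg_closed_field, field_char_0} fps set"
    and \<Gamma> S :: "nat set"
  assumes "complete_branch \<O>"
    and "\<Gamma> = value_semigroup \<O>"
    and "semigroup_module \<Gamma> S"
  shows "\<exists>A. algorithm \<Gamma> S = Some (A, {})
             \<and> minimal_generating_set \<Gamma> S A
             \<and> (\<forall>B. minimal_generating_set \<Gamma> S B \<longrightarrow> B = A)"
proof -
  interpret complete_branch \<O> by fact
  obtain e where "e \<in> \<Gamma>" "e > 0"
    using value_semigroup_pos assms(2) by blast
  then interpret nontrivial_semigroup \<Gamma> e
    using value_semigroup_zero value_semigroup_add assms(2) by unfold_locales auto
  show ?thesis
    using algorithm_eq minimal_generating_set_iff[OF assms(3)] by simp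
qed

end
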